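(* Let $d$ be either $0$ or a positive square-free integer, $K=\mathbb{Q}(\sqrt{-d})$, $R$ the ring of integers of $K$. (a) $\omega(\Gamma_{1,n})=2$ for all $n\geq1$. (b) $\omega(\Gamma^{un}_{2,n})=2n+1$ for all $n\geq1$.
   Context: $\omega(\cdot)$ denotes the clique number of a graph. The zero-divisor graph $\Gamma(M_2(R))$ is the directed graph whose vertices are the nonzero (left or right) zero-divisors of $M_2(R)$, with an edge $v_1\to v_2$ between distinct vertices iff $v_1v_2=0$. For an integer $N\geq1$ and $t\in R$, let $S_{tc,1,t,N}=\{\lambda\begin{bmatrix}1&t\\t^2&t^3\end{bmatrix}:\lambda\in\mathbb{Z},\,1\leq|\lambda|\leq N\}$ and $S_{tc,2,N}=\{\begin{bmatrix}0&0\\0&\lambda\end{bmatrix}:\lambda\in\mathbb{Z},\,1\leq|\lambda|\leq N\}$. Let $\Gamma_{1,N}$ be the induced subgraph of $\Gamma(M_2(R))$ on $S_{tc,1,0,N}\cup S_{tc,2,N}$, regarded as an undirected graph. Let $U=\{\pm1\}$ if $d\neq1,3$, $U=\{\pm1,\pm i\}$ if $d=1$ ($i=\sqrt{-1}$), $U=\{\pm1,\pm\zeta,\pm\zeta^2\}$ if $d=3$ ($\zeta$ a primitive third root of unity); let $\Gamma_{2,N}$ be the induced subgraph of $\Gamma(M_2(R))$ on $\bigcup_{j\in U}S_{tc,1,j,N}$, and $\Gamma^{un}_{2,N}$ its underlying undirected graph (distinct $v_1,v_2$ adjacent iff $v_1v_2=0$ or $v_2v_1=0$). *)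

theory Defs
  imports
    "HOL-Analysis.Analysis"
    "HOL-Computational_Algebra.Polynomial"
    "HOL-Computational_Algebra.Squarefree"
    "HOL-Library.Extended_Nat"
    "Graph_Theory.Digraph_Component"
begin

definition is_subfield :: "'a::field set \<Rightarrow> bool" where
  "is_subfield F \<longleftrightarrow> 0 \<in> F \<and> 1 \<in> F \<and>
     (\<forall>x\<in>F. \<forall>y\<in>F. x + y \<in> F \<and> x * y \<in> F) \<and> (\<forall>x\<in>F. - x \<in> F \<and> inverse x \<in> F)"

definition imag_quadratic_field :: "nat \<Rightarrow> complex set" where
  "imag_quadratic_field d = \<Inter> {F. is_subfield F \<and> csqrt (- of_nat d) \<in> F}"

definition ring_of_integers :: "'a::field set \<Rightarrow> 'a set" where
  "ring_of_integers K = {x \<in> K. algebraic_int x}"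

definition primitive_root_unity :: "nat \<Rightarrow> 'a::monoid_mult \<Rightarrow> bool" where
  "primitive_root_unity m z \<longleftrightarrow> 0 < m \<and> z ^ m = 1 \<and> (\<forall>k. 0 < k \<and> k < m \<longrightarrow> z ^ k \<noteq> 1)"

definition mat2 :: "'a::zero \<Rightarrow> 'a \<Rightarrow> 'a \<Rightarrow> 'a \<Rightarrow> 'a^2^2" where
  "mat2 a b c d = vector [vector [a, b], vector [c, d]]"

definition matrices2 :: "'a set \<Rightarrow> ('a^2^2) set" where
  "matrices2 R = {A. \<forall>i j. A $ i $ j \<in> R}"

definition M2_zero_divisors :: "'a::ring_1 set \<Rightarrow> ('a^2^2) set" where
  "M2_zero_divisors R =
     {A \<in> matrices2 R. A \<noteq> 0 \<and> (\<exists>B\<in>matrices2 R. B \<noteq> 0 \<and> (A ** B = 0 \<or> B ** A = 0))}"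

definition zero_divisor_graph :: "'a::ring_1 set \<Rightarrow> ('a^2^2) pair_pre_digraph" where
  "zero_divisor_graph R =
     \<lparr> pverts = M2_zero_divisors R,
       parcs = {(A, B). A \<in> M2_zero_divisors R \<and> B \<in> M2_zero_divisors R \<and>
                        A \<noteq> B \<and> A ** B = 0} \<rparr>"

definition S_tc1 :: "complex \<Rightarrow> nat \<Rightarrow> (complex^2^2) set" where
  "S_tc1 t N = {of_int l *\<^sub>R mat2 1 t (t^2) (t^3) | l :: int. 1 \<le> \<bar>l\<bar> \<and> \<bar>l\<bar> \<le> int N}"

definition S_tc2 :: "nat \<Rightarrow> (complex^2^2) set" where
  "S_tc2 N = {mat2 0 0 0 (of_int l) | l :: int. 1 \<le> \<bar>l\<bar> \<and> \<bar>l\<bar> \<le> int N}"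

definition U_set :: "nat \<Rightarrow> complex \<Rightarrow> complex set" where
  "U_set d \<zeta> =
     (if d = 1 then {1, -1, \<i>, - \<i>}
      else if d = 3 then {1, -1, \<zeta>, - \<zeta>, \<zeta>^2, - (\<zeta>^2)}
      else {1, -1})"

definition Gamma1 :: "nat \<Rightarrow> nat \<Rightarrow> (complex^2^2, (complex^2^2) \<times> (complex^2^2)) pre_digraph" where
  "Gamma1 d N =
     induce_subgraph (zero_divisor_graph (ring_of_integers (imag_quadratic_field d)))
       (S_tc1 0 N \<union> S_tc2 N)"

definition Gamma2 ::
  "nat \<Rightarrow> complex \<Rightarrow> nat \<Rightarrow> (complex^2^2, (complex^2^2) \<times> (complex^2^2)) pre_digraph" where
  "Gamma2 d \<zeta> N =
     induce_subgraph (zero_divisor_graph (ring_of_integers (imag_quadratic_field d)))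
       (\<Union>j\<in>U_set d \<zeta>. S_tc1 j N)"

text \<open>Undirected graphs are symmetric digraphs; \<^const>\<open>mk_symmetric\<close> gives the underlying
  undirected graph of a digraph. The clique number takes values in \<^typ>\<open>enat\<close>, so that it is
  \<open>\<infinity>\<close> for graphs with arbitrarily large finite cliques.\<close>

definition is_clique :: "('a, 'b) pre_digraph \<Rightarrow> 'a set \<Rightarrow> bool" where
  "is_clique G C \<longleftrightarrow> C \<subseteq> verts G \<and> (\<forall>u\<in>C. \<forall>v\<in>C. u \<noteq> v \<longrightarrow> (u, v) \<in> arcs_ends G)"

definition clique_number :: "('a, 'b) pre_digraph \<Rightarrow> enat" where
  "clique_number G = Sup {enat (card C) | C. finite C \<and> is_clique G C}"

end

theory Submission
  imports Defs
begin

text \<open>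
  The matrix with parameter \<open>t\<close> is the rank one product of the column \<open>(1, t\<^sup>2)\<close> and the row
  \<open>(1, t)\<close>, so the product of the matrices with parameters \<open>s\<close> and \<open>t\<close> vanishes iff
  \<open>s t\<^sup>2 = -1\<close>. Hence two distinct multiples of one such matrix are adjacent iff \<open>t\<^sup>3 = -1\<close>, and if
  \<open>t\<^sup>3 = -1\<close> then every neighbour has parameter \<open>t\<close> or \<open>-t\<close>. A clique that contains such a \<open>t\<close> thus
  consists of at most \<open>2n\<close> multiples with parameter \<open>t\<close> and at most one with parameter \<open>-t\<close>.
  Any other clique contains at most one multiple for each parameter \<open>t\<close> with \<open>t\<^sup>3 \<noteq> -1\<close>, and \<open>U\<close>
  has at most three such elements. The bound is attained by the multiples with parameter
  \<open>-1\<close> together with one matrix with parameter \<open>1\<close>.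
\<close>

section \<open>Arithmetic of two-by-two matrices and the rank one family
  \<open>tc_mat\<close>\<close>

lemma mat2_nth [simp]:
  "mat2 a b c d $ 1 $ 1 = a" "mat2 a b c d $ 1 $ 2 = b"
  "mat2 a b c d $ 2 $ 1 = c" "mat2 a b c d $ 2 $ 2 = d"
  by (simp_all add: mat2_def)

lemma mat2_eq_iff: "mat2 a b c d = mat2 a' b' c' d' \<longleftrightarrow> a = a' \<and> b = b' \<and> c = c' \<and> d = d'"
  by (auto simp: vec_eq_iff forall_2)

lemma mat2_eq_0_iff: "mat2 a b c d = 0 \<longleftrightarrow> a = 0 \<and> b = 0 \<and> c = 0 \<and> d = 0"
  by (auto simp: vec_eq_iff forall_2)

lemma mat2_mult:
  fixes a :: "'a::semiring_1"
  shows "mat2 a b c d ** mat2 a' b' c' d' =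
    mat2 (a * a' + b * c') (a * b' + b * d') (c * a' + d * c') (c * b' + d * d')"
  by (simp add: vec_eq_iff forall_2 matrix_matrix_mult_def sum_2)

lemma mat2_in_matrices2_iff:
  "mat2 a b c d \<in> matrices2 R \<longleftrightarrow> a \<in> R \<and> b \<in> R \<and> c \<in> R \<and> d \<in> R"
  by (auto simp: matrices2_def forall_2)

text \<open>The scalar is complex and multiplied into the entries, so that \<open>mat2_mult\<close>
  computes products directly; \<open>S_tc1_eq\<close> trades the real scaling in
  \<open>S_tc1\<close> for it.\<close>

definition tc_mat :: "complex \<Rightarrow> complex \<Rightarrow> complex^2^2" where
  "tc_mat t c = mat2 c (c * t) (c * t^2) (c * t^3)"

lemma tc_mat_eq_iff: "c \<noteq> 0 \<Longrightarrow> tc_mat s c = tc_mat t c' \<longleftrightarrow> s = t \<and> c = c'"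
  by (auto simp: tc_mat_def mat2_eq_iff)

lemma tc_mat_eq_0_iff [simp]: "tc_mat t c = 0 \<longleftrightarrow> c = 0"
  by (auto simp: tc_mat_def mat2_eq_0_iff)

lemma tc_mat_mult_eq_0_iff:
  assumes "c \<noteq> 0" "c' \<noteq> 0"
  shows "tc_mat s c ** tc_mat t c' = 0 \<longleftrightarrow> s * t^2 = -1"
proof -
  \<comment> \<open>The factor \<open>1 + s * t^2\<close> is the row \<open>(1, s)\<close> times the
    column \<open>(1, t^2)\<close>. It occurs in every entry and, up to \<open>c * c'\<close>, is
    the whole top left entry, which gives both directions.\<close>
  have "tc_mat s c ** tc_mat t c' =
      mat2 (c * c' * (1 + s * t^2)) (c * c' * (1 + s * t^2) * t)
        (c * c' * (1 + s * t^2) * s^2) (c * c' * (1 + s * t^2) * (s^2 * t))"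
    by (simp add: tc_mat_def mat2_mult mat2_eq_iff algebra_simps power2_eq_square power3_eq_cube)
  then show ?thesis
    using assms by (auto simp: mat2_eq_0_iff add_eq_0_iff add.commute)
qed

section \<open>Integer multiples forming the vertex sets\<close>

definition nonzero_upto :: "nat \<Rightarrow> int set" where
  "nonzero_upto N = {l. 1 \<le> \<bar>l\<bar> \<and> \<bar>l\<bar> \<le> int N}"

lemma nonzero_upto_eq: "nonzero_upto N = {- int N..int N} - {0}"
  by (auto simp: nonzero_upto_def)

lemma finite_nonzero_upto [simp]: "finite (nonzero_upto N)"
  by (simp add: nonzero_upto_eq)

lemma card_nonzero_upto [simp]: "card (nonzero_upto N) = 2 * N"
  by (simp add: nonzero_upto_eq)

lemma nonzero_if_in_nonzero_upto: "l \<in> nonzero_upto N \<Longrightarrow> l \<noteq> 0"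
  by (simp add: nonzero_upto_eq)

lemma S_tc1_eq: "S_tc1 t N = (\<lambda>l. tc_mat t (of_int l)) ` nonzero_upto N"
proof -
  have "of_int l *\<^sub>R mat2 1 t (t^2) (t^3) = tc_mat t (of_int l)" for l :: int
    by (simp add: vec_eq_iff forall_2 tc_mat_def scaleR_conv_of_real[where 'a = complex])
  then show ?thesis
    by (auto simp: S_tc1_def nonzero_upto_def)
qed

lemma S_tc2_eq: "S_tc2 N = (\<lambda>l. mat2 0 0 0 (of_int l)) ` nonzero_upto N"
  by (auto simp: S_tc2_def nonzero_upto_def)

lemma inj_on_tc_mat: "inj_on (\<lambda>l::int. tc_mat t (of_int l)) (nonzero_upto N)"
  by (auto intro!: inj_onI simp: tc_mat_eq_iff nonzero_if_in_nonzero_upto)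

lemma card_S_tc1: "card (S_tc1 t N) = 2 * N"
  by (simp add: S_tc1_eq card_image inj_on_tc_mat)

lemma finite_S_tc1: "finite (S_tc1 t N)"
  by (simp add: S_tc1_eq)

lemma of_int_in_subfield:
  assumes "is_subfield F"
  shows "of_int m \<in> F"
proof -
  have nat: "of_nat k \<in> F" for k
    using assms by (induction k) (auto simp: is_subfield_def)
  show ?thesis
    using assms nat by (cases m rule: int_cases2) (auto simp: is_subfield_def)
qed

text \<open>Integers are algebraic integers and lie in each of the intersected subfields. This puts
  the clique witnesses below into \<open>matrices2 R\<close>.\<close>

lemma of_int_in_ring_of_integers: "of_int m \<in> ring_of_integers (imag_quadratic_field d)"
  by (simp add: ring_of_integers_def imag_quadratic_field_def of_int_in_subfield)

section \<open>Cliques in symmetrised induced subgraphs\<close>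

abbreviation sym_induced :: "'a::ring_1 set \<Rightarrow> ('a^2^2) set \<Rightarrow> ('a^2^2) pair_pre_digraph" where
  "sym_induced R S \<equiv> mk_symmetric (induce_subgraph (with_proj (zero_divisor_graph R)) S)"

text \<open>\<open>induce_subgraph\<close> takes \<open>S\<close> itself as vertex set, so
  membership in \<open>M2_zero_divisors R\<close> comes from the arcs and is asserted for distinct
  pairs only.\<close>

lemma is_clique_sym_induced_iff:
  "is_clique (with_proj (sym_induced R S)) C \<longleftrightarrow>
     C \<subseteq> S \<and> (\<forall>A\<in>C. \<forall>B\<in>C. A \<noteq> B \<longrightarrow>
       A \<in> M2_zero_divisors R \<and> B \<in> M2_zero_divisors R \<and> (A ** B = 0 \<or> B ** A = 0))"
  unfolding is_clique_def
  by (fastforce simp: mk_symmetric_def arcs_ends_def arc_to_ends_def zero_divisor_graph_def)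

lemma clique_number_eqI:
  assumes "finite C" "is_clique G C" "card C = k"
    and "\<And>D. finite D \<Longrightarrow> is_clique G D \<Longrightarrow> card D \<le> k"
  shows "clique_number G = enat k"
  unfolding clique_number_def
proof (rule Sup_eqI)
  fix y assume "\<And>z. z \<in> {enat (card C) |C. finite C \<and> is_clique G C} \<Longrightarrow> z \<le> y"
  then show "enat k \<le> y"
    using assms(1-3) by blast
qed (use assms(4) in auto)

lemma M2_zero_divisorI:
  assumes "A \<in> matrices2 R" "B \<in> matrices2 R" "A \<noteq> 0" "B \<noteq> 0" "A ** B = 0 \<or> B ** A = 0"
  shows "A \<in> M2_zero_divisors R"
  using assms by (auto simp: M2_zero_divisors_def)

section \<open>Clique number of the diagonal graph\<close>

lemma clique_number_diagonal:
  fixes R :: "complex set"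
  assumes R: "\<And>m. of_int m \<in> R" and n: "n \<ge> 1"
  shows "clique_number (with_proj (sym_induced R (S_tc1 0 n \<union> S_tc2 n))) = 2"
proof -
  \<comment> \<open>These are diag(1, 0) and diag(0, 1), orthogonal idempotents that certify each
    other as zero divisors.\<close>
  let ?E = "tc_mat 0 1" and ?F = "mat2 0 0 0 (1::complex)"
  have in_R: "0 \<in> R" "1 \<in> R"
    using R[of 0] R[of 1] by auto
  have neq: "?E \<noteq> ?F"
    by (simp add: tc_mat_def mat2_eq_iff)
  have mats: "?E \<in> matrices2 R" "?F \<in> matrices2 R" "?E \<noteq> 0" "?F \<noteq> 0"
    "?E ** ?F = 0" "?F ** ?E = 0"
    using in_R by (simp_all add: tc_mat_def mat2_in_matrices2_iff mat2_eq_0_iff mat2_mult)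
  have zd: "?E \<in> M2_zero_divisors R" "?F \<in> M2_zero_divisors R"
    using mats by (blast intro: M2_zero_divisorI)+
  have "1 \<in> nonzero_upto n"
    using n by (simp add: nonzero_upto_def)
  then have mem: "?E \<in> S_tc1 0 n" "?F \<in> S_tc2 n"
    by (force simp: S_tc1_eq S_tc2_eq)+
  have "clique_number (with_proj (sym_induced R (S_tc1 0 n \<union> S_tc2 n))) = enat 2"
  proof (rule clique_number_eqI[where C = "{?E, ?F}"])
    show "is_clique (with_proj (sym_induced R (S_tc1 0 n \<union> S_tc2 n))) {?E, ?F}"
      unfolding is_clique_sym_induced_iff using mem zd mats(5,6) by auto
    show "card {?E, ?F} = 2"
      using neq by simp
  next
    fix D assume fin: "finite D"
      and "is_clique (with_proj (sym_induced R (S_tc1 0 n \<union> S_tc2 n))) D"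
    then have sub: "D \<subseteq> S_tc1 0 n \<union> S_tc2 n"
      and adj: "\<And>A B. A \<in> D \<Longrightarrow> B \<in> D \<Longrightarrow> A \<noteq> B \<Longrightarrow> A ** B = 0 \<or> B ** A = 0"
      unfolding is_clique_sym_induced_iff by blast+
    \<comment> \<open>Neither family contains two adjacent matrices: for parameter 0 the criterion
      reads 0 = -1, and for \<open>S_tc2\<close> the bottom right entry of a product is a product of
      nonzero integers.\<close>
    have "card (D \<inter> S_tc1 0 n) \<le> Suc 0"
    proof (subst card_le_Suc0_iff_eq)
      show "\<forall>A\<in>D \<inter> S_tc1 0 n. \<forall>B\<in>D \<inter> S_tc1 0 n. A = B"
      proof (intro ballI, rule ccontr)
        fix A B assume AB: "A \<in> D \<inter> S_tc1 0 n" "B \<in> D \<inter> S_tc1 0 n" "A \<noteq> B"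
        then have "A ** B = 0 \<or> B ** A = 0"
          using adj by blast
        then show False
          using AB(1,2) by (auto simp: S_tc1_eq tc_mat_mult_eq_0_iff nonzero_if_in_nonzero_upto)
      qed
    qed (use fin in auto)
    moreover have "card (D \<inter> S_tc2 n) \<le> Suc 0"
    proof (subst card_le_Suc0_iff_eq)
      show "\<forall>A\<in>D \<inter> S_tc2 n. \<forall>B\<in>D \<inter> S_tc2 n. A = B"
      proof (intro ballI, rule ccontr)
        fix A B assume AB: "A \<in> D \<inter> S_tc2 n" "B \<in> D \<inter> S_tc2 n" "A \<noteq> B"
        then have "A ** B = 0 \<or> B ** A = 0"
          using adj by blast
        then show False
          using AB(1,2)
          by (auto simp: S_tc2_eq mat2_mult mat2_eq_0_iff nonzero_if_in_nonzero_upto)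
      qed
    qed (use fin in auto)
    moreover have "D = (D \<inter> S_tc1 0 n) \<union> (D \<inter> S_tc2 n)"
      using sub by blast
    ultimately show "card D \<le> 2"
      using card_Un_le[of "D \<inter> S_tc1 0 n" "D \<inter> S_tc2 n"] by simp
  qed simp
  then show ?thesis
    by (simp add: numeral_eq_enat)
qed

section \<open>Clique number for parameters in a set of units\<close>

lemma clique_number_tc:
  fixes R U :: "complex set"
  assumes R: "\<And>m. of_int m \<in> R" and n: "n \<ge> 1"
    and U: "1 \<in> U" "-1 \<in> U" "finite U" "card {t \<in> U. t^3 \<noteq> -1} \<le> 3"
  shows "clique_number (with_proj (sym_induced R (\<Union>t\<in>U. S_tc1 t n))) = enat (2 * n + 1)"
proof (rule clique_number_eqI)
  let ?E = "tc_mat 1 1"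
  let ?C = "insert ?E (S_tc1 (-1) n)"
  have in_R: "1 \<in> R" "-1 \<in> R"
    using R[of 1] R[of "-1"] by auto
  have one: "1 \<in> nonzero_upto n"
    using n by (simp add: nonzero_upto_def)
  have "?E \<notin> S_tc1 (-1) n"
    by (auto simp: S_tc1_eq tc_mat_eq_iff)
  then show "card ?C = 2 * n + 1"
    by (simp add: card_S_tc1 finite_S_tc1)
  show "finite ?C"
    by (simp add: finite_S_tc1)
  \<comment> \<open>With left parameter -1 the criterion becomes \<open>t^2 = 1\<close>, true for 1
    and -1. Products with \<open>?E\<close> on the left and parameter -1 on the right do not vanish,
    so symmetrisation matters here.\<close>
  have prod: "A ** B = 0" if "A \<in> S_tc1 (-1) n" "B \<in> ?C" for A B
    using that by (auto simp: S_tc1_eq tc_mat_mult_eq_0_iff nonzero_if_in_nonzero_upto)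
  have mats: "A \<in> matrices2 R" "A \<noteq> 0" if "A \<in> ?C" for A
    using that R R[of "- l" for l] in_R
    by (auto simp: S_tc1_eq nonzero_if_in_nonzero_upto)
      (auto simp: tc_mat_def mat2_in_matrices2_iff)
  \<comment> \<open>A common left annihilator of \<open>?C\<close>, itself included, hence a witness
    that every member is a zero divisor.\<close>
  have "tc_mat (-1) 1 \<in> S_tc1 (-1) n"
    using one by (force simp: S_tc1_eq)
  then have zd: "A \<in> M2_zero_divisors R" if "A \<in> ?C" for A
    using that prod mats by (meson M2_zero_divisorI insertCI)
  have "?E \<in> S_tc1 1 n"
    using one by (force simp: S_tc1_eq)
  then have "?C \<subseteq> (\<Union>t\<in>U. S_tc1 t n)"
    using U(1,2) by blast
  then show "is_clique (with_proj (sym_induced R (\<Union>t\<in>U. S_tc1 t n))) ?C"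
    unfolding is_clique_sym_induced_iff using prod zd by blast
next
  fix D assume fin: "finite D"
    and "is_clique (with_proj (sym_induced R (\<Union>t\<in>U. S_tc1 t n))) D"
  then have sub: "D \<subseteq> (\<Union>t\<in>U. S_tc1 t n)"
    and adj: "\<And>A B. A \<in> D \<Longrightarrow> B \<in> D \<Longrightarrow> A \<noteq> B \<Longrightarrow> A ** B = 0 \<or> B ** A = 0"
    unfolding is_clique_sym_induced_iff by blast+
  have adj': "s * t^2 = -1 \<or> t * s^2 = -1"
    if "A \<in> D \<inter> S_tc1 s n" "B \<in> D \<inter> S_tc1 t n" "A \<noteq> B" for A B s t
    using that adj[of A B]
    by (auto simp: S_tc1_eq tc_mat_mult_eq_0_iff nonzero_if_in_nonzero_upto)
  have single: "card (D \<inter> S_tc1 t n) \<le> 1" if "t^3 \<noteq> -1" for t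
  proof -
    have "\<forall>A\<in>D \<inter> S_tc1 t n. \<forall>B\<in>D \<inter> S_tc1 t n. A = B"
      using adj'[of _ t _ t] that by (metis power3_eq_cube power2_eq_square mult.assoc)
    then show ?thesis
      using fin by (simp add: card_le_Suc0_iff_eq)
  qed
  show "card D \<le> 2 * n + 1"
  proof (cases "\<exists>t. t^3 = -1 \<and> D \<inter> S_tc1 t n \<noteq> {}")
    case True
    then obtain t A where t: "t^3 = -1" and A: "A \<in> D \<inter> S_tc1 t n"
      by blast
    have t0: "t \<noteq> 0"
      using t by auto
    have "D \<subseteq> S_tc1 t n \<union> (D \<inter> S_tc1 (-t) n)"
    proof
      fix B assume B: "B \<in> D"
      then obtain s where s: "B \<in> S_tc1 s n"
        using sub by blast
      show "B \<in> S_tc1 t n \<union> (D \<inter> S_tc1 (-t) n)"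
      proof (cases "A = B")
        case False
        \<comment> \<open>Writing -1 as \<open>t^3\<close> makes both adjacency conditions
          cancellable by powers of \<open>t\<close>.\<close>
        then have "t * s^2 = t^3 \<or> s * t^2 = t^3"
          using adj'[OF A, of B s] B s t by auto
        then have "s^2 = t^2 \<or> s = t"
          using t0 by (auto simp: power2_eq_square power3_eq_cube)
        then have "s = t \<or> s = -t"
          by (auto simp: power2_eq_iff)
        then show ?thesis
          using B s by auto
      qed (use A in auto)
    qed
    then have "card D \<le> card (S_tc1 t n \<union> (D \<inter> S_tc1 (-t) n))"
      using fin by (intro card_mono) (auto simp: finite_S_tc1)
    also have "\<dots> \<le> card (S_tc1 t n) + card (D \<inter> S_tc1 (-t) n)"
      by (rule card_Un_le)
    \<comment> \<open>Since \<open>(-t)^3 = 1\<close>, the bound \<open>single\<close> applies to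
      \<open>-t\<close>.\<close>
    also have "\<dots> \<le> 2 * n + 1"
      using single[of "-t"] t by (simp add: card_S_tc1)
    finally show ?thesis .
  next
    case False
    let ?V = "{t \<in> U. t^3 \<noteq> -1}"
    have "D = (\<Union>t\<in>?V. D \<inter> S_tc1 t n)"
      using sub False by blast
    then have "card D \<le> (\<Sum>t\<in>?V. card (D \<inter> S_tc1 t n))"
      using card_UN_le[of ?V "\<lambda>t. D \<inter> S_tc1 t n"] U(3) by simp
    also have "\<dots> \<le> (\<Sum>t\<in>?V. 1)"
      using single by (intro sum_mono) auto
    \<comment> \<open>The bound 3 on the number of parameters suffices because
      \<open>n \<ge> 1\<close>; for \<open>n = 1\<close> it equals \<open>2 * n + 1\<close>.\<close>
    also have "\<dots> \<le> 2 * n + 1"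
      using U(4) n by simp
    finally show ?thesis .
  qed
qed

section \<open>Cubes of the units and conclusion\<close>

lemma card_U_set_cube_neq:
  assumes "primitive_root_unity 3 \<zeta>"
  shows "card {t \<in> U_set d \<zeta>. t^3 \<noteq> -1} \<le> 3"
proof -
  have \<zeta>: "\<zeta>^3 = 1"
    using assms by (simp add: primitive_root_unity_def)
  have "(\<zeta>^2)^3 = (\<zeta>^3)^2"
    by (simp flip: power_mult)
  then have "(- \<zeta>)^3 = -1" "(- (\<zeta>^2))^3 = -1"
    using \<zeta> by simp_all
  \<comment> \<open>For \<open>d = 1\<close> the cubes of \<i> and -\<i> are -\<i> and \<i>, so only
    -1 drops out. The other set is what remains for \<open>d = 3\<close>, and it contains 1, which
    is all that remains for other \<open>d\<close>.\<close>
  then have "{t \<in> U_set d \<zeta>. t^3 \<noteq> -1} \<subseteq> (if d = 1 then {1, \<i>, - \<i>} else {1, \<zeta>, \<zeta>^2})"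
    by (auto simp: U_set_def)
  then have "card {t \<in> U_set d \<zeta>. t^3 \<noteq> -1} \<le> card (if d = 1 then {1, \<i>, - \<i>} else {1, \<zeta>, \<zeta>^2})"
    by (rule card_mono[rotated]) simp
  also have "\<dots> \<le> 3"
    using card_length[of "[1, \<i>, - \<i>]"] card_length[of "[1, \<zeta>, \<zeta>^2]"] by simp
  finally show ?thesis .
qed

theorem theorem3p19:
  fixes d :: nat and \<zeta> :: complex
  assumes "d = 0 \<or> (d > 0 \<and> squarefree d)"
    and "primitive_root_unity 3 \<zeta>"
  shows "(\<forall>n::nat. n \<ge> 1 \<longrightarrow> clique_number (with_proj (mk_symmetric (Gamma1 d n))) = 2) \<and>
         (\<forall>n::nat. n \<ge> 1 \<longrightarrow>
            clique_number (with_proj (mk_symmetric (Gamma2 d \<zeta> n))) = enat (2 * n + 1))"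
proof (intro conjI allI impI)
  fix n :: nat assume n: "n \<ge> 1"
  show "clique_number (with_proj (mk_symmetric (Gamma1 d n))) = 2"
    unfolding Gamma1_def by (rule clique_number_diagonal[OF of_int_in_ring_of_integers n])
  show "clique_number (with_proj (mk_symmetric (Gamma2 d \<zeta> n))) = enat (2 * n + 1)"
    unfolding Gamma2_def
    by (rule clique_number_tc[OF of_int_in_ring_of_integers n _ _ _ card_U_set_cube_neq[OF assms(2)]])
      (auto simp: U_set_def)
qed

end
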